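(* For any $\sigma\mathsf{k}$-separable topological space $X$ and any cometrizable space $Y$, the function space $C_k(X,Y)$ is cometrizable.
   Context: A topological space $Y$ is called cometrizable if it admits a weaker (i.e. contained in the original topology) metrizable topology such that each point $y\in Y$ has a (not necessarily open) neighborhood base, with respect to the original topology of $Y$, consisting of sets that are closed in the metrizable topology. A topological space $X$ is $\sigma\mathsf{k}$-separable if it contains a $\sigma$-compact set $D\subseteq X$ such that each compact set $K\subseteq X$ is contained in a compact set $C\subseteq X$ such that $K\subseteq\overline{C\cap D}$. $C_k(X,Y)$ denotes the set of all continuous functions from $X$ to $Y$ endowed with the compact-open topology, i.e. the topology generated by the subbase consisting of the sets $\{f\in C(X,Y):f(K)\subseteq U\}$, where $K\subseteq X$ is compact and $U\subseteq Y$ is open. *)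

theory Defs
  imports "HOL-Analysis.Analysis"
begin

text \<open>
  The predicate \<open>closedin Z\<close> refers to the weaker metrizable topology \<open>Z\<close>, whereas the neighbourhood
  base is taken in \<open>Y\<close>; \<^const>\<open>neighbourhood_base_of\<close> does not require its members to be open.
\<close>

definition cometrizable_space :: "'a topology \<Rightarrow> bool" where
  "cometrizable_space Y \<longleftrightarrow>
     (\<exists>Z. topspace Z = topspace Y \<and> (\<forall>U. openin Z U \<longrightarrow> openin Y U) \<and>
          metrizable_space Z \<and> neighbourhood_base_of (closedin Z) Y)"

definition sigma_compactin :: "'a topology \<Rightarrow> 'a set \<Rightarrow> bool" where
  "sigma_compactin X D \<longleftrightarrow>
     (\<exists>\<K>. countable \<K> \<and> (\<forall>K\<in>\<K>. compactin X K) \<and> D = \<Union>\<K>)"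

text \<open>No separation axiom is assumed, so compact sets need not be closed.\<close>

definition sigma_k_separable_space :: "'a topology \<Rightarrow> bool" where
  "sigma_k_separable_space X \<longleftrightarrow>
     (\<exists>D. sigma_compactin X D \<and>
          (\<forall>K. compactin X K \<longrightarrow>
               (\<exists>C. compactin X C \<and> K \<subseteq> C \<and> K \<subseteq> X closure_of (C \<inter> D))))"

text \<open>
  A continuous function from \<open>X\<close> to \<open>Y\<close> is represented by the unique HOL function that agrees with
  it on \<^term>\<open>topspace X\<close> and is \<^const>\<open>undefined\<close> elsewhere.
\<close>

definition continuous_maps :: "'a topology \<Rightarrow> 'b topology \<Rightarrow> ('a \<Rightarrow> 'b) set" where
  "continuous_maps X Y = {f \<in> extensional (topspace X). continuous_map X Y f}"

definition compact_open_topology :: "'a topology \<Rightarrow> 'b topology \<Rightarrow> ('a \<Rightarrow> 'b) topology" where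
  "compact_open_topology X Y =
     topology_generated_by
       {{f \<in> continuous_maps X Y. f ` K \<subseteq> U} | K U. compactin X K \<and> openin Y U}"

lemma topspace_compact_open_topology:
  "topspace (compact_open_topology X Y) = continuous_maps X Y"
proof -
  have "continuous_maps X Y \<in>
          {{f \<in> continuous_maps X Y. f ` K \<subseteq> U} | K U. compactin X K \<and> openin Y U}"
    by (rule CollectI, rule exI[of _ "{}"], rule exI[of _ "{}"]) auto
  then show ?thesis
    unfolding compact_open_topology_def topology_generated_by_topspace by blast
qed

end

theory Submission
  imports Defs
begin

text \<open>
  Let \<open>Z\<close> be the coarser metrizable topology on \<open>Y\<close>, with metric \<open>d\<close>, and let \<open>D\<close> be the union of the
  countable family \<open>\<K>\<close> of compact sets that witnesses \<open>\<sigma>k\<close>-separability of \<open>X\<close>.  The coarser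
  metrizable topology on the function space is that of \<open>d\<close>-uniform convergence on each member of
  \<open>\<K>\<close>.  It is the topology induced by the map that sends \<open>f\<close> to the family of its restrictions to the
  sets \<open>K \<in> \<K>\<close>, with values in the countable product of the metric spaces of bounded functions
  \<open>K \<rightarrow> Z\<close>.  This map is injective because \<open>D\<close> is dense and \<open>Z\<close> is Hausdorff, and it is
  continuous because uniform convergence on a compact set is no finer than the compact-open topology.

  It remains to find, inside a subbasic set \<open>{g. g ` K \<subseteq> U}\<close> around \<open>f\<close>, a neighbourhood of \<open>f\<close>
  that is closed for this metrizable topology.  Evaluation at a point of \<open>D\<close> is continuous for it, so
  every condition \<open>g ` (L \<inter> D) \<subseteq> W\<close> with \<open>W\<close> closed in \<open>Z\<close> defines a closed set, and by continuity
  of \<open>g\<close> such a condition controls \<open>g\<close> on the closure of \<open>L \<inter> D\<close>.  The hypothesis on \<open>X\<close> provides a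
  compact \<open>C\<close> with \<open>K\<close> contained in the closure of \<open>C \<inter> D\<close>.  Sets closed in \<open>Z\<close> are closed in
  \<open>Y\<close>, so \<open>Y\<close> is regular; this yields finitely many compact pieces \<open>L\<close> of \<open>C\<close> such
  that \<open>f\<close> maps each \<open>L\<close> into an open \<open>V\<close> with \<open>V \<subseteq> W \<subseteq> U\<close>,
  where \<open>W\<close> is closed in \<open>Z\<close>, and such that the closures of the sets \<open>L \<inter> D\<close> cover \<open>K\<close>.  The
  conjunction of the conditions \<open>g ` (L \<inter> D) \<subseteq> W\<close> is the required neighbourhood.
\<close>

section \<open>Neighbourhood bases and coarser metrizable topologies\<close>

lemma neighbourhood_base_of_topology_generated_by:
  assumes Int: "\<And>A B. P A \<Longrightarrow> P B \<Longrightarrow> P (A \<inter> B)"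
    and subbase: "\<And>S x. S \<in> \<S> \<Longrightarrow> x \<in> S \<Longrightarrow>
      \<exists>U V. openin (topology_generated_by \<S>) U \<and> P V \<and> x \<in> U \<and> U \<subseteq> V \<and> V \<subseteq> S"
  shows "neighbourhood_base_of P (topology_generated_by \<S>)"
proof -
  let ?T = "topology_generated_by \<S>"
  have "\<exists>U V. openin ?T U \<and> P V \<and> x \<in> U \<and> U \<subseteq> V \<and> V \<subseteq> S"
    if "generate_topology_on \<S> S" "x \<in> S" for S x
    using that
  proof (induction arbitrary: x rule: generate_topology_on.induct)
    case Empty
    then show ?case by simp
  next
    case (Int A B)
    then obtain U1 V1 U2 V2 where
      "openin ?T U1" "P V1" "x \<in> U1" "U1 \<subseteq> V1" "V1 \<subseteq> A"
      "openin ?T U2" "P V2" "x \<in> U2" "U2 \<subseteq> V2" "V2 \<subseteq> B"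
      by (metis IntD1 IntD2)
    then show ?case
      by (intro exI[of _ "U1 \<inter> U2"] exI[of _ "V1 \<inter> V2"]) (auto intro: assms(1))
  next
    case (UN \<U>)
    then obtain A where A: "A \<in> \<U>" "x \<in> A" by blast
    then obtain U V where "openin ?T U" "P V" "x \<in> U" "U \<subseteq> V" "V \<subseteq> A"
      using UN.IH by metis
    then show ?case
      using A(1) by (meson Union_upper order_trans)
  next
    case (Basis S)
    then show ?case using subbase by blast
  qed
  then show ?thesis
    unfolding neighbourhood_base_of by (blast dest: openin_topology_generated_by)
qed

text \<open>
  The topology pulled back along the injection \<open>F\<close> turns \<open>F\<close> into a homeomorphism onto a subspace
  of \<open>P\<close>, so it is metrizable; continuity of \<open>F\<close> says exactly that it is coarser than \<open>T\<close>.
\<close>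

lemma metrizable_pullback_of_injection:
  assumes P: "metrizable_space P" and cont: "continuous_map T P F" and inj: "inj_on F (topspace T)"
  obtains Z where "topspace Z = topspace T" "\<And>U. openin Z U \<Longrightarrow> openin T U"
    "metrizable_space Z" "continuous_map Z P F"
proof -
  let ?Z = "pullback_topology (topspace T) F P"
  have top: "topspace ?Z = topspace T"
    using cont by (auto simp: topspace_pullback_topology continuous_map_def)
  have contZ: "continuous_map ?Z P F"
    using continuous_map_pullback[of P P id] by simp
  have coarser: "openin T U" if "openin ?Z U" for U
  proof -
    obtain V where "openin P V" "U = F -` V \<inter> topspace T"
      using \<open>openin ?Z U\<close> by (auto simp: openin_pullback_topology)
    then show ?thesis
      using cont by (simp add: continuous_map_alt)
  qed
  have opn: "open_map ?Z (subtopology P (F ` topspace T)) F"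
    unfolding open_map_def
  proof (intro allI impI)
    fix U assume "openin ?Z U"
    then obtain V where "openin P V" "U = F -` V \<inter> topspace T"
      by (auto simp: openin_pullback_topology)
    moreover have "F ` (F -` V \<inter> topspace T) = V \<inter> F ` topspace T" by auto
    ultimately show "openin (subtopology P (F ` topspace T)) (F ` U)"
      by (auto simp: openin_subtopology)
  qed
  have cts: "continuous_map ?Z (subtopology P (F ` topspace T)) F"
    using contZ by (auto simp: continuous_map_in_subtopology top)
  have onto: "F ` topspace ?Z = topspace (subtopology P (F ` topspace T))"
    using cont by (auto simp: top continuous_map_def)
  have "homeomorphic_map ?Z (subtopology P (F ` topspace T)) F"
    by (rule bijective_open_imp_homeomorphic_map[OF cts opn onto]) (use inj top in simp)
  then have metr: "metrizable_space ?Z"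
    using homeomorphic_metrizable_space[OF homeomorphic_map_imp_homeomorphic_space]
      metrizable_space_subtopology[OF P] by blast
  show thesis
    by (rule that[OF top coarser metr contZ])
qed

section \<open>Uniform convergence on a compact set\<close>

lemma (in Metric_space) continuous_map_eval_funspace:
  assumes "x \<in> K"
  shows "continuous_map (Metric_space.mtopology (fspace K) (fdist K)) mtopology (\<lambda>g. g x)"
proof -
  interpret F: Metric_space "fspace K" "fdist K"
    by (rule Metric_space_funspace)
  have le: "d (f x) (g x) \<le> fdist K f g" if "f \<in> fspace K" "g \<in> fspace K" for f g
    using funspace_mdist_le[OF that] assms by blast
  have M: "f x \<in> M" if "f \<in> fspace K" for f
    using that assms by (auto simp: fspace_def)
  show ?thesis
    unfolding continuous_map_to_metric
  proof (intro ballI allI impI)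
    fix f and e :: real
    assume f: "f \<in> topspace F.mtopology" and "0 < e"
    moreover have "g x \<in> mball (f x) e" if "g \<in> F.mball f e" for g
      using that le[of f g] M by auto
    ultimately show "\<exists>U. openin F.mtopology U \<and> f \<in> U \<and> (\<forall>g\<in>U. g x \<in> mball (f x) e)"
      by (intro exI[of _ "F.mball f e"]) auto
  qed
qed

lemma openin_compact_open_subbasic:
  assumes "compactin X K" "openin Y U"
  shows "openin (compact_open_topology X Y) {f \<in> continuous_maps X Y. f ` K \<subseteq> U}"
  unfolding compact_open_topology_def
  by (rule topology_generated_by_Basis) (use assms in blast)

text \<open>
  For \<open>f\<close> and \<open>e > 0\<close>, finitely many balls of radius \<open>e / 4\<close> cover the compact set \<open>f ` K\<close>.  The
  preimages in \<open>K\<close> of the corresponding closed balls are relatively closed in \<open>K\<close>, hence compact, and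
  a map that sends each of them into the concentric open ball of radius \<open>e / 2\<close> stays within
  \<open>3 * e / 4\<close> of \<open>f\<close> on \<open>K\<close>.
\<close>

lemma (in Metric_space) continuous_map_restrict_funspace:
  assumes top: "topspace Y = M" and coarser: "\<And>U. openin mtopology U \<Longrightarrow> openin Y U"
    and K: "compactin X K"
  shows "continuous_map (compact_open_topology X Y) (Metric_space.mtopology (fspace K) (fdist K))
           (\<lambda>f. restrict f K)"
proof -
  interpret F: Metric_space "fspace K" "fdist K"
    by (rule Metric_space_funspace)
  let ?T = "compact_open_topology X Y"
  have cont: "continuous_map X mtopology f" if "f \<in> continuous_maps X Y" for f
    using that top coarser by (auto simp: continuous_maps_def continuous_map_def)
  have KX: "K \<subseteq> topspace X"
    using K by (rule compactin_subset_topspace)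
  have fspace: "restrict f K \<in> fspace K" if f: "f \<in> continuous_maps X Y" for f
  proof -
    have "compactin mtopology (f ` K)"
      using image_compactin[OF K cont[OF f]] .
    then show ?thesis
      using compactin_imp_mbounded compactin_subset_topspace by (fastforce simp: fspace_def)
  qed
  show ?thesis
    unfolding F.continuous_map_to_metric topspace_compact_open_topology
  proof (intro ballI allI impI)
    fix f and e :: real
    assume f: "f \<in> continuous_maps X Y" and e: "0 < e"
    have fM: "f x \<in> M" if "x \<in> K" for x
      using cont[OF f] KX that by (auto simp: continuous_map_def)
    have "compactin mtopology (f ` K)"
      using image_compactin[OF K cont[OF f]] .
    moreover have "f ` K \<subseteq> \<Union> ((\<lambda>x. mball (f x) (e/4)) ` K)"
      using fM e by auto
    ultimately obtain A where A: "finite A" "A \<subseteq> K" and cov: "f ` K \<subseteq> (\<Union>a\<in>A. mball (f a) (e/4))"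
      using compactinD[of mtopology "f ` K" "(\<lambda>x. mball (f x) (e/4)) ` K"]
      by (smt (verit, best) finite_subset_image imageE openin_mball)
    define L where "L a = {x \<in> topspace X. f x \<in> mcball (f a) (e/4)} \<inter> K" for a
    have L: "compactin X (L a)" for a
      unfolding L_def
      by (intro closed_Int_compactin K closedin_continuous_map_preimage[OF cont[OF f]] closedin_mcball)
    \<comment> \<open>The first set is all of \<open>continuous_maps X Y\<close>, written as a subbasic open set; it is the value
      of \<open>U\<close> when \<open>A\<close> is empty.\<close>
    define U where "U = {g \<in> continuous_maps X Y. g ` K \<subseteq> topspace Y} \<inter>
      (\<Inter>a\<in>A. {g \<in> continuous_maps X Y. g ` L a \<subseteq> mball (f a) (e/2)})"
    have Uin: "g \<in> U \<longleftrightarrow> g \<in> continuous_maps X Y \<and> (\<forall>a\<in>A. g ` L a \<subseteq> mball (f a) (e/2))" for g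
    proof -
      have "g ` K \<subseteq> topspace Y" if "g \<in> continuous_maps X Y"
        using that KX by (auto simp: continuous_maps_def continuous_map_def)
      then show ?thesis
        unfolding U_def by blast
    qed
    have "openin ?T U"
    proof (cases "A = {}")
      case True
      then show ?thesis
        using openin_compact_open_subbasic[OF K openin_topspace] by (simp add: U_def)
    next
      case False
      then show ?thesis
        unfolding U_def using A(1) L
        by (intro openin_Int openin_INT2 openin_compact_open_subbasic K openin_topspace coarser) auto
    qed
    moreover have "f \<in> U"
      unfolding Uin using f e by (auto simp: L_def)
    moreover have "restrict g K \<in> F.mball (restrict f K) e" if g: "g \<in> U" for g
    proof -
      have gc: "g \<in> continuous_maps X Y"
        using g Uin by blast
      have near: "d (f x) (g x) \<le> 3 * e / 4" if x: "x \<in> K" for x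
      proof -
        obtain a where a: "a \<in> A" "f x \<in> mball (f a) (e/4)"
          using cov x by blast
        then have "x \<in> L a"
          using x KX by (auto simp: L_def)
        then have "g x \<in> mball (f a) (e/2)"
          using g a(1) Uin by blast
        then show ?thesis
          using a(2) triangle[of "f x" "f a" "g x"] commute[of "f x" "f a"] by auto
      qed
      have "fdist K (restrict f K) (restrict g K) < e"
      proof (cases "K = {}")
        case True
        then show ?thesis using e by (simp add: fdist_def)
      next
        case False
        then have "fdist K (restrict f K) (restrict g K) \<le> 3 * e / 4"
          unfolding funspace_mdist_le[OF fspace[OF f] fspace[OF gc] False] using near by simp
        then show ?thesis using e by linarith
      qed
      then show ?thesis
        using fspace[OF f] fspace[OF gc] by simp
    qed
    ultimately show "\<exists>U. openin ?T U \<and> f \<in> U \<and> (\<forall>g\<in>U. restrict g K \<in> F.mball (restrict f K) e)"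
      by (intro exI[of _ U] conjI ballI)
  qed
qed

text \<open>
  The topology is that of uniform convergence on the members of \<open>\<K>\<close>.  Countability of \<open>\<K>\<close> makes
  the product of the spaces of bounded functions metrizable, and density of \<open>\<Union>\<K>\<close> makes the map
  into it injective.  The evaluations factor through it, and their continuity is how closed sets of
  the topology are recognised later.
\<close>

lemma compact_open_topology_metrizable_coarsening:
  fixes X :: "'a topology" and Y Z :: "'b topology"
  assumes Z: "metrizable_space Z" "topspace Z = topspace Y" "\<And>U. openin Z U \<Longrightarrow> openin Y U"
    and \<K>: "countable \<K>" "\<And>K. K \<in> \<K> \<Longrightarrow> compactin X K"
    and dense: "X closure_of (\<Union>\<K>) = topspace X"
  obtains T where "topspace T = continuous_maps X Y"
    "\<And>U. openin T U \<Longrightarrow> openin (compact_open_topology X Y) U" "metrizable_space T"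
    "\<And>x. x \<in> \<Union>\<K> \<Longrightarrow> continuous_map T Z (\<lambda>g. g x)"
proof -
  obtain M d where "Metric_space M d" and Zeq: "Z = Metric_space.mtopology M d"
    using Z(1) by (auto simp: metrizable_space_def)
  then interpret Metric_space M d by simp
  let ?B = "\<lambda>K :: 'a set. Metric_space.mtopology (fspace K) (fdist K)"
  let ?P = "product_topology ?B \<K>"
  let ?C = "compact_open_topology X Y"
  let ?F = "\<lambda>f. \<lambda>K\<in>\<K>. restrict f K"
  have "metrizable_space (?B K)" for K
    by (rule Metric_space.metrizable_space_mtopology[OF Metric_space_funspace])
  then have "metrizable_space ?P"
    using \<K>(1) by (simp add: metrizable_space_product_topology)
  moreover have "continuous_map ?C ?P ?F"
    unfolding continuous_map_componentwise
    using continuous_map_restrict_funspace[of Y X] Z Zeq \<K>(2) by auto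
  moreover have "inj_on ?F (topspace ?C)"
  proof (rule inj_onI)
    fix f g assume fg: "f \<in> topspace ?C" "g \<in> topspace ?C" and eq: "?F f = ?F g"
    have "f x = g x" if "x \<in> \<Union>\<K>" for x
      using that eq by (metis UnionE restrict_apply')
    moreover have "continuous_map X Z f" "continuous_map X Z g"
      using fg Z(2,3)
      by (auto simp: topspace_compact_open_topology continuous_maps_def continuous_map_def)
    ultimately have "f x = g x" if "x \<in> topspace X" for x
      using that dense forall_in_closure_of_eq[of x X "\<Union>\<K>" Z f g]
        metrizable_imp_Hausdorff_space[OF Z(1)] by auto
    then show "f = g"
      using fg by (auto simp: topspace_compact_open_topology continuous_maps_def intro: extensionalityI)
  qed
  ultimately obtain T where T: "topspace T = topspace ?C" "\<And>U. openin T U \<Longrightarrow> openin ?C U"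
      "metrizable_space T" "continuous_map T ?P ?F"
    by (rule metrizable_pullback_of_injection) blast
  have eval: "continuous_map T Z (\<lambda>g. g x)" if x: "x \<in> \<Union>\<K>" for x
  proof -
    obtain K where K: "K \<in> \<K>" "x \<in> K" using x by blast
    have "continuous_map T (?B K) (\<lambda>g. ?F g K)"
      using T(4) K(1) by (simp add: continuous_map_componentwise)
    from continuous_map_compose[OF this continuous_map_eval_funspace[OF K(2)]]
    show ?thesis
      using K Zeq by (simp add: o_def)
  qed
  have "topspace T = continuous_maps X Y"
    using T(1) by (simp add: topspace_compact_open_topology)
  then show thesis
    using T(2,3) eval by (rule that)
qed

section \<open>Closed neighbourhoods in the compact-open topology\<close>

text \<open>
  Using the base twice, every point of \<open>f ` K\<close> gets nested neighbourhoods \<open>V' \<subseteq> W' \<subseteq> V \<subseteq> W \<subseteq> U\<close>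
  with \<open>V', V\<close> open in \<open>Y\<close> and \<open>W', W\<close> closed in \<open>Z\<close>.  Finitely many of the preimages of the sets
  \<open>V'\<close> cover \<open>K\<close>, and the preimages in \<open>C\<close> of the corresponding \<open>W'\<close> are the compact pieces.  The
  open sets \<open>V'\<close> are there for the last claim: a point of \<open>K\<close> is in the closure of \<open>C \<inter> D\<close>, so if
  it lies in the open preimage of \<open>V'\<close>, it is in the closure of the part of \<open>C \<inter> D\<close> inside that
  preimage, which is a part of \<open>L \<inter> D\<close>.
\<close>

lemma compact_pieces_with_dense_traces:
  fixes X :: "'a topology" and Y Z :: "'b topology"
  assumes coarser: "topspace Z = topspace Y" "\<And>U. openin Z U \<Longrightarrow> openin Y U"
    and base: "neighbourhood_base_of (closedin Z) Y"
    and f: "continuous_map X Y f" and K: "compactin X K" and C: "compactin X C"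
    and KC: "K \<subseteq> X closure_of (C \<inter> D)" and U: "openin Y U" "f ` K \<subseteq> U"
  obtains A :: "'a set" and L V W where "finite A"
    "\<forall>a\<in>A. compactin X (L a) \<and> openin Y (V a) \<and> closedin Z (W a) \<and>
       f ` L a \<subseteq> V a \<and> V a \<subseteq> W a \<and> W a \<subseteq> U"
    "K \<subseteq> (\<Union>a\<in>A. X closure_of (L a \<inter> D))"
proof -
  have closedY: "closedin Y S" if "closedin Z S" for S
    using that coarser by (simp add: closedin_def)
  have "\<exists>V W V' W'. openin Y V \<and> closedin Z W \<and> openin Y V' \<and> closedin Z W' \<and>
      f x \<in> V' \<and> V' \<subseteq> W' \<and> W' \<subseteq> V \<and> V \<subseteq> W \<and> W \<subseteq> U" if "x \<in> K" for x
  proof -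
    have "f x \<in> U" using that U(2) by blast
    then obtain V W where V: "openin Y V" "closedin Z W" "f x \<in> V" "V \<subseteq> W" "W \<subseteq> U"
      using base U(1) unfolding neighbourhood_base_of by metis
    then obtain V' W' where "openin Y V'" "closedin Z W'" "f x \<in> V'" "V' \<subseteq> W'" "W' \<subseteq> V"
      using base unfolding neighbourhood_base_of by metis
    with V show ?thesis by blast
  qed
  then obtain V W V' W' where VW: "\<And>x. x \<in> K \<Longrightarrow> openin Y (V x) \<and> closedin Z (W x) \<and>
      openin Y (V' x) \<and> closedin Z (W' x) \<and>
      f x \<in> V' x \<and> V' x \<subseteq> W' x \<and> W' x \<subseteq> V x \<and> V x \<subseteq> W x \<and> W x \<subseteq> U"
    by metis
  define G where "G x = {y \<in> topspace X. f y \<in> V' x}" for x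
  have G: "openin X (G x)" if "x \<in> K" for x
    unfolding G_def using VW[OF that] openin_continuous_map_preimage[OF f] by blast
  have "K \<subseteq> \<Union> (G ` K)"
    using VW compactin_subset_topspace[OF K] by (auto simp: G_def)
  with K G obtain \<G> where "finite \<G>" "\<G> \<subseteq> G ` K" "K \<subseteq> \<Union>\<G>"
    unfolding compactin_def by (metis (no_types, lifting) imageE)
  then obtain A where A: "finite A" "A \<subseteq> K" and cov: "K \<subseteq> \<Union> (G ` A)"
    by (metis finite_subset_image)
  define L where "L x = {y \<in> topspace X. f y \<in> W' x} \<inter> C" for x
  show thesis
  proof
    show "finite A" by fact
    have "compactin X (L a)" if "a \<in> A" for a
      unfolding L_def
      using VW A(2) that closedY
      by (intro closed_Int_compactin C closedin_continuous_map_preimage[OF f]) auto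
    moreover have "f ` L a \<subseteq> V a" if "a \<in> A" for a
      using VW[of a] A(2) that by (auto simp: L_def)
    ultimately show "\<forall>a\<in>A. compactin X (L a) \<and> openin Y (V a) \<and> closedin Z (W a) \<and>
        f ` L a \<subseteq> V a \<and> V a \<subseteq> W a \<and> W a \<subseteq> U"
      using VW A(2) by blast
    show "K \<subseteq> (\<Union>a\<in>A. X closure_of (L a \<inter> D))"
    proof
      fix k assume k: "k \<in> K"
      then obtain a where a: "a \<in> A" "k \<in> G a" using cov by blast
      then have "k \<in> X closure_of (G a \<inter> (C \<inter> D))"
        using openin_Int_closure_of_subset[OF G, of a "C \<inter> D"] A(2) k KC by blast
      moreover have "G a \<inter> (C \<inter> D) \<subseteq> L a \<inter> D"
        using VW[of a] A(2) a(1) by (auto simp: G_def L_def)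
      ultimately show "k \<in> (\<Union>a\<in>A. X closure_of (L a \<inter> D))"
        using a(1) closure_of_mono by blast
    qed
  qed
qed

text \<open>
  With the pieces \<open>L\<close> and the sets \<open>V \<subseteq> W\<close> of the preceding lemma, the open neighbourhood asks for
  \<open>g ` L \<subseteq> V\<close> and the closed one only for \<open>g ` (L \<inter> D) \<subseteq> W\<close>.  The latter restricts \<open>g\<close> at points of
  \<open>D\<close> only, so it is closed for any topology that makes these evaluations continuous into \<open>Z\<close>.
\<close>

lemma closed_neighbourhood_in_compact_open_subbasic:
  fixes X :: "'a topology" and Y Z :: "'b topology"
  assumes coarser: "topspace Z = topspace Y" "\<And>U. openin Z U \<Longrightarrow> openin Y U"
    and base: "neighbourhood_base_of (closedin Z) Y"
    and T: "topspace T = continuous_maps X Y" "\<And>x. x \<in> D \<Longrightarrow> continuous_map T Z (\<lambda>g. g x)"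
    and K: "compactin X K" and C: "compactin X C" and KC: "K \<subseteq> X closure_of (C \<inter> D)"
    and U: "openin Y U" and f: "f \<in> continuous_maps X Y" "f ` K \<subseteq> U"
  shows "\<exists>O' N. openin (compact_open_topology X Y) O' \<and> closedin T N \<and>
           f \<in> O' \<and> O' \<subseteq> N \<and> N \<subseteq> {g \<in> continuous_maps X Y. g ` K \<subseteq> U}"
proof -
  have cf: "continuous_map X Y f" using f(1) by (simp add: continuous_maps_def)
  obtain A :: "'a set" and L V W where A: "finite A"
    and pieces: "\<forall>a\<in>A. compactin X (L a) \<and> openin Y (V a) \<and> closedin Z (W a) \<and>
      f ` L a \<subseteq> V a \<and> V a \<subseteq> W a \<and> W a \<subseteq> U"
    and cov: "K \<subseteq> (\<Union>a\<in>A. X closure_of (L a \<inter> D))"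
    by (rule compact_pieces_with_dense_traces[OF coarser base cf K C KC U f(2)])
  have L: "compactin X (L a)" and V: "openin Y (V a)" and W: "closedin Z (W a)"
    and fL: "f ` L a \<subseteq> V a" and VW: "V a \<subseteq> W a" and WU: "W a \<subseteq> U" if "a \<in> A" for a
    using pieces that by auto
  let ?S = "continuous_maps X Y"
  define O' where "O' = ?S \<inter> (\<Inter>a\<in>A. {g \<in> ?S. g ` L a \<subseteq> V a})"
  define N where "N = \<Inter> (insert ?S ((\<lambda>(a, x). {g \<in> ?S. g x \<in> W a}) ` (SIGMA a:A. L a \<inter> D)))"
  have Nin: "g \<in> N \<longleftrightarrow> g \<in> ?S \<and> (\<forall>a\<in>A. g ` (L a \<inter> D) \<subseteq> W a)" for g
    by (auto simp: N_def)
  have "openin (compact_open_topology X Y) O'"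
  proof (cases "A = {}")
    case True
    then show ?thesis
      using openin_topspace[of "compact_open_topology X Y"]
      by (simp add: O'_def topspace_compact_open_topology)
  next
    case False
    have "openin (compact_open_topology X Y) ?S"
      by (metis openin_topspace topspace_compact_open_topology)
    then show ?thesis
      unfolding O'_def using A L V False
      by (intro openin_Int openin_INT2 openin_compact_open_subbasic) auto
  qed
  moreover have "closedin T N"
    unfolding N_def
  proof (rule closedin_Inter)
    fix S assume "S \<in> insert ?S ((\<lambda>(a, x). {g \<in> ?S. g x \<in> W a}) ` (SIGMA a:A. L a \<inter> D))"
    then consider "S = ?S" | a x where "a \<in> A" "x \<in> D" "S = {g \<in> ?S. g x \<in> W a}" by blast
    then show "closedin T S"
    proof cases
      case 1
      then show ?thesis by (metis T(1) closedin_topspace)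
    next
      case 2
      then show ?thesis
        using closedin_continuous_map_preimage[OF T(2) W] T(1) by simp
    qed
  qed auto
  moreover have "f \<in> O'"
    using f(1) fL by (auto simp: O'_def)
  moreover have "O' \<subseteq> N"
  proof
    fix g assume "g \<in> O'"
    then show "g \<in> N"
      using VW unfolding Nin O'_def by fast
  qed
  moreover have "N \<subseteq> {g \<in> ?S. g ` K \<subseteq> U}"
  proof clarify
    fix g assume g: "g \<in> N"
    then have gS: "g \<in> ?S" by (simp add: Nin)
    have "g k \<in> U" if k: "k \<in> K" for k
    proof -
      obtain a where a: "a \<in> A" "k \<in> X closure_of (L a \<inter> D)" using cov k by blast
      have "closedin Y (W a)"
        using W[OF a(1)] coarser by (simp add: closedin_def)
      then have "Y closure_of (g ` (L a \<inter> D)) \<subseteq> W a"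
        using g a(1) by (simp add: Nin closure_of_minimal)
      moreover have "g k \<in> Y closure_of (g ` (L a \<inter> D))"
        using continuous_map_image_closure_subset[of X Y g] gS a(2) by (auto simp: continuous_maps_def)
      ultimately show ?thesis using WU[OF a(1)] by blast
    qed
    then show "g \<in> ?S \<and> g ` K \<subseteq> U" using gS by blast
  qed
  ultimately show ?thesis by blast
qed

theorem corollary1p4:
  fixes X :: "'a topology" and Y :: "'b topology"
  assumes "sigma_k_separable_space X"
    and "cometrizable_space Y"
  shows "cometrizable_space (compact_open_topology X Y)"
proof -
  obtain Z where Z: "topspace Z = topspace Y" "\<And>U. openin Z U \<Longrightarrow> openin Y U"
      "metrizable_space Z" and base: "neighbourhood_base_of (closedin Z) Y"
    using assms(2) unfolding cometrizable_space_def by blast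
  obtain \<K> where \<K>: "countable \<K>" "\<And>K. K \<in> \<K> \<Longrightarrow> compactin X K"
    and sep: "\<And>K. compactin X K \<Longrightarrow> \<exists>C. compactin X C \<and> K \<subseteq> C \<and> K \<subseteq> X closure_of (C \<inter> \<Union>\<K>)"
    using assms(1) unfolding sigma_k_separable_space_def sigma_compactin_def by metis
  \<comment> \<open>Density of \<open>\<Union>\<K>\<close> is the separability condition applied to singletons.\<close>
  have "x \<in> X closure_of \<Union>\<K>" if x: "x \<in> topspace X" for x
  proof -
    obtain C where "{x} \<subseteq> X closure_of (C \<inter> \<Union>\<K>)"
      using sep[of "{x}"] x by auto
    then show ?thesis
      using closure_of_mono[of "C \<inter> \<Union>\<K>" "\<Union>\<K>" X] by blast
  qed
  then have "X closure_of \<Union>\<K> = topspace X"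
    using closure_of_subset_topspace by fast
  then obtain T where T: "topspace T = continuous_maps X Y"
      "\<And>U. openin T U \<Longrightarrow> openin (compact_open_topology X Y) U" "metrizable_space T"
      "\<And>x. x \<in> \<Union>\<K> \<Longrightarrow> continuous_map T Z (\<lambda>g. g x)"
    using compact_open_topology_metrizable_coarsening[OF Z(3,1,2) \<K>] by blast
  have "neighbourhood_base_of (closedin T) (compact_open_topology X Y)"
    unfolding compact_open_topology_def
  proof (rule neighbourhood_base_of_topology_generated_by, fold compact_open_topology_def)
    fix S f
    assume "S \<in> {{f \<in> continuous_maps X Y. f ` K \<subseteq> U} | K U. compactin X K \<and> openin Y U}"
      and "f \<in> S"
    then obtain K U where K: "compactin X K" and U: "openin Y U"
      and S: "S = {f \<in> continuous_maps X Y. f ` K \<subseteq> U}"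
      and f: "f \<in> continuous_maps X Y" "f ` K \<subseteq> U"
      by blast
    obtain C where C: "compactin X C" "K \<subseteq> X closure_of (C \<inter> \<Union>\<K>)"
      using sep[OF K] by blast
    show "\<exists>O' N. openin (compact_open_topology X Y) O' \<and> closedin T N \<and> f \<in> O' \<and> O' \<subseteq> N \<and> N \<subseteq> S"
      unfolding S
      by (rule closed_neighbourhood_in_compact_open_subbasic[OF Z(1,2) base T(1,4) K C U f])
  qed (rule closedin_Int)
  then show ?thesis
    unfolding cometrizable_space_def
    using T(1-3) by (metis topspace_compact_open_topology)
qed

end
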